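(* Let $\mathbf{\Lambda}$ be an $n \times n$ diagonal matrix whose diagonal is strictly positive, let $\mathcal{C}\subset\mathbb{R}^n$ be a nonempty compact, convex set, and let $\mathbf{c}$ be the center and $r$ the radius of the unique smallest sphere containing the set $$\mathbf{\Lambda}^{1/2}\mathcal{C} := \{ \mathbf{\Lambda}^{1/2}\mathbf{x} : \mathbf{x} \in \mathcal{C} \}.$$ Let $$\mathcal{S}_2 = \{ \ell: \mathbb{R}^n \rightarrow \mathbb{R} \mbox{ such that } \ell \mbox{ is affine and } -\mathbf{x}^{\sf T}\mathbf{\Lambda}\mathbf{x} \ge \ell(\mathbf{x}) \mbox{ for all } \mathbf{x} \in \mathcal{C} \}.$$ Then a best affine underestimate of $-\mathbf{x}^{\sf T}\mathbf{\Lambda}\mathbf{x}$ over $\mathcal{C}$ is $$\ell^*(\mathbf{x}) = -2\mathbf{c}^{\sf T}\mathbf{\Lambda}^{1/2}\mathbf{x} + \|\mathbf{c}\|^2 - r^2 .$$ Furthermore, $$\min_{\ell \in \mathcal{S}_2} \; \max_{\mathbf{x}\in \mathcal{C}} \; -\left( \mathbf{x}^{\sf T}\mathbf{\Lambda}\mathbf{x} + \ell(\mathbf{x}) \right) = r^2 .$$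
   Context: $\|\cdot\|$ denotes the Euclidean norm. A sphere with center $\mathbf{c}$ and radius $r\ge 0$ contains a set if every point of the set is at distance at most $r$ from $\mathbf{c}$; the smallest sphere containing a nonempty compact convex set is the one of minimal radius (it is unique). A best affine underestimate of $-\mathbf{x}^{\sf T}\mathbf{\Lambda}\mathbf{x}$ over $\mathcal{C}$ is an $\ell\in\mathcal{S}_2$ attaining the minimum in $\min_{\ell \in \mathcal{S}_2} \max_{\mathbf{x}\in \mathcal{C}} -( \mathbf{x}^{\sf T}\mathbf{\Lambda}\mathbf{x} + \ell(\mathbf{x}) )$. $\mathbf{\Lambda}^{1/2}$ is the diagonal matrix of the positive square roots of the diagonal entries of $\mathbf{\Lambda}$. *)

theory Defs
  imports "HOL-Analysis.Analysis"
begin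

text \<open>The paper's ``sphere'' is used as a solid ball: it contains a set if every point of the
  set is at distance at most the radius from the center.\<close>

definition encloses :: "'a::metric_space \<Rightarrow> real \<Rightarrow> 'a set \<Rightarrow> bool" where
  "encloses c r S \<longleftrightarrow> 0 \<le> r \<and> (\<forall>y\<in>S. dist c y \<le> r)"

definition is_smallest_sphere :: "'a::metric_space \<Rightarrow> real \<Rightarrow> 'a set \<Rightarrow> bool" where
  "is_smallest_sphere c r S \<longleftrightarrow>
     encloses c r S \<and> (\<forall>c' r'. encloses c' r' S \<longrightarrow> r \<le> r')"

definition affine_function :: "('a::real_vector \<Rightarrow> real) \<Rightarrow> bool" where
  "affine_function l \<longleftrightarrow> (\<exists>g b. linear g \<and> (\<forall>x. l x = g x + b))"

definition diagonal_matrix :: "'a::zero ^ 'n ^ 'n \<Rightarrow> bool" where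
  "diagonal_matrix A \<longleftrightarrow> (\<forall>i j. i \<noteq> j \<longrightarrow> A $ i $ j = 0)"

definition sqrt_diagonal :: "real ^ 'n ^ 'n \<Rightarrow> real ^ 'n ^ 'n" where
  "sqrt_diagonal A = (\<chi> i j. if i = j then sqrt (A $ i $ i) else 0)"

definition affine_underestimates :: "real ^ 'n ^ 'n \<Rightarrow> (real ^ 'n) set \<Rightarrow> (real ^ 'n \<Rightarrow> real) set" where
  "affine_underestimates A C =
     {l. affine_function l \<and> (\<forall>x\<in>C. - (x \<bullet> (A *v x)) \<ge> l x)}"

text \<open>The maximum over \<open>C\<close> is rendered as a supremum; on nonempty compact \<open>C\<close> it is attained
  for every affine \<open>l\<close>, see \<open>max_gap_attained\<close> below.\<close>

definition max_gap :: "real ^ 'n ^ 'n \<Rightarrow> (real ^ 'n) set \<Rightarrow> (real ^ 'n \<Rightarrow> real) \<Rightarrow> real" where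
  "max_gap A C l = (SUP x\<in>C. - (x \<bullet> (A *v x) + l x))"

definition best_affine_underestimate ::
    "real ^ 'n ^ 'n \<Rightarrow> (real ^ 'n) set \<Rightarrow> (real ^ 'n \<Rightarrow> real) \<Rightarrow> bool" where
  "best_affine_underestimate A C l \<longleftrightarrow>
     is_arg_min (max_gap A C) (\<lambda>l. l \<in> affine_underestimates A C) l"

lemma max_gap_attained:
  fixes A :: "real ^ 'n ^ 'n"
  assumes "compact C" "C \<noteq> {}" "affine_function l"
  shows "\<exists>x\<in>C. max_gap A C l = - (x \<bullet> (A *v x) + l x) \<and>
           (\<forall>y\<in>C. - (y \<bullet> (A *v y) + l y) \<le> - (x \<bullet> (A *v x) + l x))"
proof -
  let ?f = "\<lambda>x. - (x \<bullet> (A *v x) + l x)"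
  obtain g b where g: "linear g" and l: "l = (\<lambda>x. g x + b)"
    using assms(3) unfolding affine_function_def by blast
  have "continuous_on C ?f"
    unfolding l
    by (intro continuous_intros linear_continuous_on linear_conv_bounded_linear[THEN iffD1]
        g matrix_vector_mul_linear)
  then obtain x where x: "x \<in> C" "\<forall>y\<in>C. ?f y \<le> ?f x"
    using continuous_attains_sup[OF assms(1,2)] by blast
  have "Sup (?f ` C) = ?f x"
    by (rule cSup_eq_maximum) (use x in auto)
  then show ?thesis using x unfolding max_gap_def by blast
qed

lemma smallest_sphere_ex1:
  fixes S :: "'a::euclidean_space set"
  assumes "compact S" "S \<noteq> {}"
  shows "\<exists>!p. is_smallest_sphere (fst p) (snd p) S"
proof -
  obtain s where s: "s \<in> S" using assms(2) by blast
  obtain R where R: "\<forall>y\<in>S. dist s y \<le> R"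
    using compact_imp_bounded[OF assms(1)] bounded_any_center[of S s] by blast
  have R0: "0 \<le> R" using R s by force
  let ?K = "{p::'a \<times> real. 0 \<le> snd p} \<inter> {p. snd p \<le> R} \<inter> (\<Inter>y\<in>S. {p. dist (fst p) y \<le> snd p})"
  have "closed ?K"
    by (intro closed_Int closed_INT ballI closed_Collect_le continuous_intros)
  moreover have "?K \<subseteq> cball s R \<times> {0..R}" using s by (auto simp: dist_commute) force
  ultimately have "compact ?K"
    unfolding compact_eq_bounded_closed
    using bounded_subset[OF bounded_Times[OF bounded_cball bounded_closed_interval]] by blast
  moreover have "(s, R) \<in> ?K" using R R0 by auto
  ultimately obtain p where p: "p \<in> ?K" and pm: "\<And>q. q \<in> ?K \<Longrightarrow> snd p \<le> snd q"
    using continuous_attains_inf[OF _ _ continuous_on_snd[OF continuous_on_id], of ?K]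
    by (metis (no_types, lifting) empty_iff)
  have "is_smallest_sphere (fst p) (snd p) S"
    unfolding is_smallest_sphere_def
  proof (intro conjI allI impI)
    show "encloses (fst p) (snd p) S" using p by (auto simp: encloses_def)
    fix c' r' assume "encloses c' r' S"
    then show "snd p \<le> r'"
      using pm[of "(c', r')"] p by (cases "r' \<le> R") (auto simp: encloses_def)
  qed
  moreover have "p = q" if "is_smallest_sphere (fst p) (snd p) S"
    "is_smallest_sphere (fst q) (snd q) S" for p q :: "'a \<times> real"
  proof -
    define r where "r = snd p"
    define m where "m = (1/2) *\<^sub>R (fst p + fst q)"
    define d where "d = (norm (fst p - fst q))\<^sup>2 / 4"
    have r: "snd q = r" using that unfolding is_smallest_sphere_def r_def by (meson order.antisym)
    have e: "dist (fst p) y \<le> r" "dist (fst q) y \<le> r" if "y \<in> S" for y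
      using \<open>is_smallest_sphere (fst p) (snd p) S\<close> \<open>is_smallest_sphere (fst q) (snd q) S\<close> that r
      unfolding is_smallest_sphere_def encloses_def r_def by auto
    have r0: "0 \<le> r" using that(1) unfolding is_smallest_sphere_def encloses_def r_def by auto
    have b: "(dist m y)\<^sup>2 \<le> r\<^sup>2 - d" if "y \<in> S" for y
    proof -
      have "(dist m y)\<^sup>2 = (dist (fst p) y)\<^sup>2 / 2 + (dist (fst q) y)\<^sup>2 / 2 - d"
        unfolding m_def d_def dist_norm power2_norm_eq_inner
        by (simp add: inner_simps inner_commute field_simps)
      then show ?thesis using power_mono[OF e(1)[OF that], of 2] power_mono[OF e(2)[OF that], of 2]
        by simp
    qed
    have nn: "0 \<le> r\<^sup>2 - d" using b[OF s] zero_le_power2[of "dist m s"] by linarith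
    have "encloses m (sqrt (r\<^sup>2 - d)) S"
      unfolding encloses_def using b nn by (auto intro: real_le_rsqrt real_sqrt_ge_zero)
    then have "r \<le> sqrt (r\<^sup>2 - d)"
      using that(1) unfolding is_smallest_sphere_def r_def by blast
    then have "r\<^sup>2 \<le> r\<^sup>2 - d" using r0 nn power_mono[of r "sqrt (r\<^sup>2 - d)" 2] by simp
    then have "fst p = fst q" unfolding d_def by simp
    then show ?thesis using r by (simp add: prod_eq_iff r_def)
  qed
  ultimately show ?thesis by blast
qed

end

theory Submission
  imports Defs
begin

text \<open>In the coordinates \<open>y = \<Lambda>\<^sup>1\<^sup>/\<^sup>2 x\<close> every affine function has the form
  \<open>- 2 a \<bullet> y + |a|\<^sup>2 - \<rho>\<close>, and its gap to \<open>- |y|\<^sup>2\<close> is \<open>\<rho> - |y - a|\<^sup>2\<close>.  Such a function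
  underestimates iff the ball around \<open>a\<close> of squared radius \<open>\<rho>\<close> contains the image \<open>S\<close> of \<open>C\<close>.
  If \<open>p\<close> is the point of \<open>S\<close> nearest to \<open>a\<close>, then by convexity the ball around \<open>p\<close> of squared
  radius \<open>\<rho> - |p - a|\<^sup>2\<close> still contains \<open>S\<close>; so the gap at \<open>p\<close> is at least \<open>r\<^sup>2\<close>.\<close>

lemma smallest_sphere_le_gap:
  fixes S :: "'a::euclidean_space set"
  assumes "is_smallest_sphere c r S" "closed S" "convex S" "S \<noteq> {}"
    and S: "\<And>y. y \<in> S \<Longrightarrow> (dist a y)\<^sup>2 \<le> \<rho>"
  shows "\<exists>p\<in>S. r\<^sup>2 \<le> \<rho> - (dist a p)\<^sup>2"
proof
  let ?p = "closest_point S a"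
  let ?\<sigma> = "\<rho> - (dist a ?p)\<^sup>2"
  show p: "?p \<in> S"
    using assms by (simp add: closest_point_in_set)
  have "(dist ?p y)\<^sup>2 \<le> ?\<sigma>" if "y \<in> S" for y
  proof -
    \<comment> \<open>Convexity makes the angle at the nearest point \<open>?p\<close> at least a
      right one, so the law of cosines yields |a - y|^2 \<ge> |a - p|^2 + |p - y|^2.\<close>
    have "(a - ?p) \<bullet> (y - ?p) \<le> 0"
      using assms that by (simp add: closest_point_dot)
    moreover have "(dist a y)\<^sup>2 = (dist a ?p)\<^sup>2 + (dist ?p y)\<^sup>2 - 2 * ((a - ?p) \<bullet> (y - ?p))"
      unfolding dist_norm power2_norm_eq_inner
      by (simp add: inner_simps inner_commute algebra_simps)
    ultimately show ?thesis
      using S[OF that] by linarith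
  qed
  moreover have "0 \<le> ?\<sigma>"
    using S[OF p] by simp
  ultimately have "encloses ?p (sqrt ?\<sigma>) S"
    by (auto simp: encloses_def intro: real_le_rsqrt)
  then have "r \<le> sqrt ?\<sigma>" "0 \<le> r"
    using assms(1) by (auto simp: is_smallest_sphere_def encloses_def)
  then show "r\<^sup>2 \<le> ?\<sigma>"
    using \<open>0 \<le> ?\<sigma>\<close> power_mono[of r "sqrt ?\<sigma>" 2] by simp
qed

lemma sqrt_diagonal_mult_component:
  "(sqrt_diagonal A *v x) $ i = sqrt (A $ i $ i) * x $ i"
  by (simp add: sqrt_diagonal_def matrix_vector_mult_def if_distrib[of "\<lambda>t. t * _"] cong: if_cong)

lemma diagonal_matrix_mult_component:
  fixes A :: "'a::semiring_1 ^ 'n ^ 'n"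
  assumes "diagonal_matrix A"
  shows "(A *v x) $ i = A $ i $ i * x $ i"
proof -
  have "(\<Sum>j\<in>UNIV. A $ i $ j * x $ j) = (\<Sum>j\<in>UNIV. if j = i then A $ i $ i * x $ i else 0)"
    using assms by (intro sum.cong) (auto simp: diagonal_matrix_def)
  then show ?thesis
    by (simp add: matrix_vector_mult_def)
qed

lemma diagonal_quadratic_form:
  assumes "diagonal_matrix A" "\<And>i. A $ i $ i \<ge> 0"
  shows "x \<bullet> (A *v x) = (norm (sqrt_diagonal A *v x))\<^sup>2"
proof -
  have "x $ i * (A $ i $ i * x $ i) = (sqrt (A $ i $ i) * x $ i) * (sqrt (A $ i $ i) * x $ i)" for i
    using real_sqrt_mult_self[of "A $ i $ i"] assms(2)[of i]
    by (metis abs_of_nonneg mult.assoc mult.left_commute)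
  then show ?thesis
    unfolding power2_norm_eq_inner inner_vec_def sqrt_diagonal_mult_component
      diagonal_matrix_mult_component[OF assms(1)] inner_real_def
    by (intro sum.cong refl)
qed

text \<open>Strict positivity makes \<open>sqrt_diagonal A\<close> invertible, so any gradient can
  be pulled back through it; \<open>\<rho>\<close> then absorbs the constant term.\<close>

lemma affine_function_sqrt_diagonal_form:
  fixes A :: "real ^ 'n ^ 'n"
  assumes "affine_function l" "\<And>i. A $ i $ i > 0"
  obtains a \<rho> where
    "\<And>x. l x = - 2 * (a \<bullet> (sqrt_diagonal A *v x)) + (norm a)\<^sup>2 - \<rho>"
proof -
  obtain g b where g: "linear g" "\<And>x. l x = g x + b"
    using assms(1) by (auto simp: affine_function_def)
  \<comment> \<open>The adjoint of a functional, taken at 1, is its Riesz vector; \<open>a\<close>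
    solves -2 \<open>sqrt (A $ i $ i)\<close> \<open>a $ i\<close> = \<open>v $ i\<close> in each
    coordinate.\<close>
  define v where "v = adjoint g 1"
  define a :: "real ^ 'n" where "a = (\<chi> i. - (v $ i / sqrt (A $ i $ i)) / 2)"
  have nz: "A $ i $ i \<noteq> 0" for i
    using assms(2)[of i] by simp
  have "g x = v \<bullet> x" for x
    using adjoint_works[OF g(1), of x 1] by (simp add: v_def inner_commute)
  also have "v \<bullet> x = - 2 * (a \<bullet> (sqrt_diagonal A *v x))" for x
    using nz by (simp add: a_def inner_vec_def sqrt_diagonal_mult_component sum_distrib_left
        flip: sum_negf)
  finally show thesis
    using that[of a "(norm a)\<^sup>2 - b"] g(2) by simp
qed

text \<open>Completing the square. It serves both an arbitrary underestimate and the optimal one,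
  where \<open>a\<close> is \<open>c\<close> and \<open>\<rho>\<close> is
  \<open>r\<^sup>2\<close>.\<close>

lemma gap_eq_dist:
  fixes a y :: "'a::real_inner"
  shows "- ((norm y)\<^sup>2 + (- 2 * (a \<bullet> y) + (norm a)\<^sup>2 - \<rho>)) = \<rho> - (dist a y)\<^sup>2"
  unfolding dist_norm power2_norm_eq_inner
  by (simp add: inner_simps inner_commute algebra_simps)

theorem corollary3p2:
  fixes \<Lambda> :: "real ^ 'n ^ 'n"
    and C :: "(real ^ 'n) set"
    and c :: "real ^ 'n"
    and r :: real
  assumes "diagonal_matrix \<Lambda>"
    and "\<And>i. \<Lambda> $ i $ i > 0"
    and "C \<noteq> {}"
    and "compact C"
    and "convex C"
    and "is_smallest_sphere c r ((\<lambda>x. sqrt_diagonal \<Lambda> *v x) ` C)"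
  shows "best_affine_underestimate \<Lambda> C
           (\<lambda>x. - 2 * (c \<bullet> (sqrt_diagonal \<Lambda> *v x)) + (norm c)\<^sup>2 - r\<^sup>2) \<and>
         (INF l \<in> affine_underestimates \<Lambda> C. max_gap \<Lambda> C l) = r\<^sup>2"
proof -
  let ?D = "\<lambda>x. sqrt_diagonal \<Lambda> *v x"
  let ?l = "\<lambda>x. - 2 * (c \<bullet> ?D x) + (norm c)\<^sup>2 - r\<^sup>2"
  let ?U = "affine_underestimates \<Lambda> C"
  have lin: "linear ?D"
    by (rule matrix_vector_mul_linear)
  have "compact (?D ` C)"
    using lin assms(4)
    by (intro compact_continuous_image linear_continuous_on) (simp_all add: linear_linear)
  then have S: "closed (?D ` C)" "convex (?D ` C)" "?D ` C \<noteq> {}"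
    using assms(3,5) lin by (auto simp: compact_imp_closed convex_linear_image)
  have quad: "x \<bullet> (\<Lambda> *v x) = (norm (?D x))\<^sup>2" for x
    using assms(1,2) by (intro diagonal_quadratic_form less_imp_le)
  have lower: "r\<^sup>2 \<le> max_gap \<Lambda> C l" if "l \<in> ?U" for l
  proof -
    have l: "affine_function l" "\<And>x. x \<in> C \<Longrightarrow> l x \<le> - (x \<bullet> (\<Lambda> *v x))"
      using that by (auto simp: affine_underestimates_def)
    obtain a \<rho> where a: "\<And>x. l x = - 2 * (a \<bullet> ?D x) + (norm a)\<^sup>2 - \<rho>"
      using affine_function_sqrt_diagonal_form[OF l(1) assms(2)] by blast
    have gap: "- (x \<bullet> (\<Lambda> *v x) + l x) = \<rho> - (dist a (?D x))\<^sup>2" for x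
      unfolding quad a by (rule gap_eq_dist)
    \<comment> \<open>Underestimating means a nonnegative gap, which by \<open>gap\<close> is
      exactly containment in the ball.\<close>
    have "(dist a (?D x))\<^sup>2 \<le> \<rho>" if "x \<in> C" for x
      using l(2)[OF that] gap[of x] by linarith
    then obtain x where "x \<in> C" "r\<^sup>2 \<le> - (x \<bullet> (\<Lambda> *v x) + l x)"
      using smallest_sphere_le_gap[OF assms(6) S, of a \<rho>] unfolding gap by blast
    then show ?thesis
      using max_gap_attained[OF assms(4,3) l(1), of \<Lambda>] by force
  qed
  have gap: "- (x \<bullet> (\<Lambda> *v x) + ?l x) = r\<^sup>2 - (dist c (?D x))\<^sup>2" for x
    unfolding quad by (rule gap_eq_dist)
  have "affine_function ?l"
    unfolding affine_function_def
  proof (intro exI conjI allI)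
    show "linear (\<lambda>x. - 2 * (c \<bullet> ?D x))"
      by (rule linearI) (simp_all add: matrix_vector_right_distrib matrix_vector_mult_scaleR
          inner_simps algebra_simps)
  qed (rule add_diff_eq[symmetric])
  moreover have "?l x \<le> - (x \<bullet> (\<Lambda> *v x))" if "x \<in> C" for x
  proof -
    have "dist c (?D x) \<le> r"
      using assms(6) that by (simp add: is_smallest_sphere_def encloses_def)
    then show ?thesis
      using gap[of x] power_mono[of "dist c (?D x)" r 2] by simp
  qed
  ultimately have mem: "?l \<in> ?U"
    by (simp add: affine_underestimates_def)
  \<comment> \<open>Dropping the subtracted square gives this bound. The reverse one is
    \<open>lower\<close> applied to \<open>?l\<close> itself, which avoids a separate proof that
    \<open>c\<close> lies in the image of \<open>C\<close>.\<close>
  have "max_gap \<Lambda> C ?l \<le> r\<^sup>2"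
    unfolding max_gap_def gap using assms(3) by (intro cSUP_least) auto
  with lower[OF mem] have val: "max_gap \<Lambda> C ?l = r\<^sup>2"
    by simp
  have "best_affine_underestimate \<Lambda> C ?l"
    unfolding best_affine_underestimate_def is_arg_min_def val
    using mem lower by (auto simp: not_less)
  \<comment> \<open>The infimum is a genuine minimum: \<open>?l\<close> attains the lower
    bound.\<close>
  moreover have "(INF l \<in> ?U. max_gap \<Lambda> C l) = r\<^sup>2"
    using mem val lower by (intro cInf_eq_minimum) force+
  ultimately show ?thesis
    by blast
qed

end
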